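(* For any integer $m\ge1$ and constants $\beta_1,\beta_2,h_1,h_2\ge0$, $$F_m^{\mathrm{QSK}}\left(\sqrt{\beta_1^2+\beta_2^2},\sqrt{h_1^2+h_2^2}\right)\le F_m^{\mathrm{QSK}}(\beta_1,h_1)+F_m^{\mathrm{QSK}}(\beta_2,h_2).$$
   Context: Let $\sigma^x=\begin{pmatrix}0&1\\1&0\end{pmatrix}$ and $\sigma^z=\begin{pmatrix}1&0\\0&-1\end{pmatrix}$ be Pauli matrices. For $1\le i\le m$, let $\sigma^x_i,\sigma^z_i:(\mathbb{C}^2)^{\otimes m}\to(\mathbb{C}^2)^{\otimes m}$ be the linear operators acting by $\sigma^x$, respectively $\sigma^z$, on the $i$-th tensor factor and by the identity $I_2$ on the other factors. For constants $\beta,h\ge0$, the quantum SK Hamiltonian with Gaussian transverse field is the random operator on $(\mathbb{C}^2)^{\otimes m}$ $$M_m=\frac{\beta}{\sqrt m}\sum_{1\le i,j\le m}J_{i,j}\,\sigma^z_i\sigma^z_j+h\sum_{i=1}^m J_i\,\sigma^x_i,$$ where all the $J_{i,j}$ ($1\le i,j\le m$) and $J_i$ ($1\le i\le m$) are i.i.d. standard real Gaussians. The free energy is $F_m^{\mathrm{QSK}}(\beta,h)=\mathbb{E}\log\left(\mathrm{Tr}(e^{M_m})/2^m\right)$. *)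

theory Defs
  imports "HOL-Analysis.Analysis" "HOL-Probability.Probability"
begin

text \<open>
  The sites \<open>1, \<dots>, m\<close> are the elements of a finite type \<open>'m\<close>, so \<open>m = CARD('m)\<close>.  The standard
  product basis vectors of \<open>(\<complex>\<^sup>2)\<^bsup>\<otimes>m\<^esup>\<close> are labelled by the configurations \<open>s :: 'm \<Rightarrow> 2\<close>, and
  operators are identified with their matrices in this basis.
\<close>

type_synonym 'm op = "complex ^ ('m \<Rightarrow> 2) ^ ('m \<Rightarrow> 2)"

definition pauli_x :: "complex ^ 2 ^ 2" where
  "pauli_x = vector [vector [0, 1], vector [1, 0]]"

definition pauli_z :: "complex ^ 2 ^ 2" where
  "pauli_z = vector [vector [1, 0], vector [0, -1]]"

text \<open>
  The matrix of the tensor product of the operators \<open>A i\<close>: its \<open>(s, t)\<close> entry is the product of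
  the \<open>(s i, t i)\<close> entries of the factors.
\<close>

definition tensor_op :: "('m::finite \<Rightarrow> complex ^ 2 ^ 2) \<Rightarrow> 'm op" where
  "tensor_op A = (\<chi> s t. \<Prod>i\<in>UNIV. A i $ s i $ t i)"

definition site_op :: "complex ^ 2 ^ 2 \<Rightarrow> 'm::finite \<Rightarrow> 'm op" where
  "site_op P i = tensor_op (\<lambda>k. if k = i then P else mat 1)"

text \<open>
  The power series is written out because the multiplication of the type class instances for
  vectors is componentwise, so \<open>exp\<close> is not available for the matrix product \<open>**\<close>.
\<close>

definition mat_exp :: "complex ^ 'n ^ 'n \<Rightarrow> complex ^ 'n ^ 'n" where
  "mat_exp A = (\<Sum>k. (1 / fact k) *\<^sub>R (((**) A) ^^ k) (mat 1))"

definition qsk_hamiltonian ::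
  "real \<Rightarrow> real \<Rightarrow> ('m \<times> 'm \<Rightarrow> real) \<Rightarrow> ('m \<Rightarrow> real) \<Rightarrow> 'm::finite op" where
  "qsk_hamiltonian \<beta> h J K =
     (\<beta> / sqrt (real CARD('m))) *\<^sub>R
       (\<Sum>i\<in>UNIV. \<Sum>j\<in>UNIV. J (i, j) *\<^sub>R (site_op pauli_z i ** site_op pauli_z j))
     + h *\<^sub>R (\<Sum>i\<in>UNIV. K i *\<^sub>R site_op pauli_x i)"

text \<open>
  The joint law of the disorder: independent standard Gaussians indexed by the disjoint union of
  the pairs of sites (couplings) and the sites (transverse fields).
\<close>

definition disorder :: "('m::finite \<times> 'm + 'm \<Rightarrow> real) measure" where
  "disorder = (\<Pi>\<^sub>M a\<in>UNIV. std_normal_distribution)"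

text \<open>
  The Hamiltonian is Hermitian, so the trace of its exponential is a positive real number and
  taking the real part only changes the type.
\<close>

definition qsk_free_energy :: "'m::finite itself \<Rightarrow> real \<Rightarrow> real \<Rightarrow> real" where
  "qsk_free_energy _ \<beta> h =
     (\<integral>g. ln (Re (trace (mat_exp (qsk_hamiltonian \<beta> h (\<lambda>p. g (Inl p)) (\<lambda>i. g (Inr i)))))
               / 2 ^ CARD('m))
      \<partial>(disorder :: ('m \<times> 'm + 'm \<Rightarrow> real) measure))"

end

theory Submission
  imports Defs
begin

text \<open>
  Write \<open>N = 2\<^sup>m\<close>, and let \<open>H(w)\<close> be the Hamiltonian at \<open>\<beta> = h = 1\<close> with disorder \<open>w\<close>; it is linear
  in \<open>w\<close>, so general strengths only rescale the coordinates of \<open>w\<close>.  Conjugation by a product of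
  Pauli matrices only changes the signs of the coordinates of \<open>w\<close>: conjugating by \<open>\<sigma>\<^sup>x\<close>'s flips
  spins, hence signs of the couplings, and conjugating by \<open>\<sigma>\<^sup>z\<close>'s flips signs of the fields.  Such
  sign changes preserve the Gaussian law.

  For Hermitian \<open>A\<close>, \<open>B\<close> and any Pauli product \<open>U\<close>, the Golden-Thompson inequality gives
  \<open>Tr (exp (U A U\<^sup>* + B)) \<le> Tr (U (exp A) U\<^sup>* (exp B))\<close>.  The average of \<open>U X U\<^sup>*\<close> over all \<open>4\<^sup>m\<close> products is
  \<open>(Tr X / N)\<close> times the identity, so by concavity of the logarithm the average over \<open>U\<close> of
  \<open>ln (Tr (exp (U A U\<^sup>* + B)) / N)\<close> is at most \<open>ln (Tr (exp A) / N) + ln (Tr (exp B) / N)\<close>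
  (lemma \<open>sum_twist_ln_le\<close>).  This holds for every realisation of the disorder.  Take for \<open>A\<close> and \<open>B\<close>
  Hamiltonians with independent disorders and strengths \<open>(\<beta>\<^sub>1, h\<^sub>1)\<close> and \<open>(\<beta>\<^sub>2, h\<^sub>2)\<close>.  By linearity
  \<open>U A U\<^sup>* + B\<close> is again a Hamiltonian whose disorder is a signed sum of independent Gaussians, so it
  has the law of the Hamiltonian of strengths \<open>sqrt (\<beta>\<^sub>1\<^sup>2 + \<beta>\<^sub>2\<^sup>2)\<close>, \<open>sqrt (h\<^sub>1\<^sup>2 + h\<^sub>2\<^sup>2)\<close> for each \<open>U\<close>
  (lemma \<open>distr_gauss_vec_combination\<close>), and taking expectations gives the claim.

  The Golden-Thompson inequality is proved through the approximation of \<open>exp A\<close> by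
  \<open>(1 + A / n)\<^sup>n\<close>.  For \<open>n = 2\<^sup>k\<close> and Hermitian \<open>X\<close>, \<open>Y\<close> one has
  \<open>Tr ((X Y)\<^sup>n) \<le> Tr (X\<^sup>n Y\<^sup>n)\<close>, which rests on a Hoelder inequality for the Schatten norms whose
  exponent is a power of two (lemma \<open>schatten_hoelder\<close>); for these exponents the Cauchy-Schwarz
  inequality and an induction suffice.
\<close>

section \<open>Complex matrices: adjoint, powers and trace\<close>

definition dagger :: "complex^'n^'m \<Rightarrow> complex^'m^'n" where
  "dagger A = (\<chi> i j. cnj (A $ j $ i))"

definition mpow :: "complex^'n^'n \<Rightarrow> nat \<Rightarrow> complex^'n^'n" where
  "mpow A k = (((**) A) ^^ k) (mat 1)"

text \<open>
  Only real parts of traces are compared below.  The real part of \<open>Tr (X\<^sup>* Y)\<close> is the Euclidean inner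
  product of matrices (lemma \<open>inner_eq_retr\<close>), so Cauchy-Schwarz for it is the one for \<open>\<bullet>\<close>.
\<close>

definition retr :: "complex^'n^'n \<Rightarrow> real" where
  "retr A = Re (trace A)"

lemma dagger_mult: "dagger (A ** B) = dagger B ** dagger A"
  by (simp add: dagger_def matrix_matrix_mult_def vec_eq_iff mult.commute)

lemma dagger_dagger [simp]: "dagger (dagger A) = A"
  by (simp add: dagger_def vec_eq_iff)

lemma dagger_mat1 [simp]: "dagger (mat 1) = mat 1"
  by (simp add: dagger_def vec_eq_iff mat_def)

lemma dagger_add: "dagger (A + B) = dagger A + dagger B"
  by (simp add: dagger_def vec_eq_iff)

lemma dagger_scaleR: "dagger (c *\<^sub>R A) = c *\<^sub>R dagger A"
  by (simp add: dagger_def vec_eq_iff)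

lemma mpow_0 [simp]: "mpow A 0 = mat 1"
  by (simp add: mpow_def)

lemma mpow_Suc: "mpow A (Suc k) = A ** mpow A k"
  by (simp add: mpow_def)

lemma mpow_1 [simp]: "mpow A (Suc 0) = A"
  by (simp add: mpow_Suc)

lemma mpow_add: "mpow A (j + k) = mpow A j ** mpow A k"
  by (induction j) (simp_all add: mpow_Suc matrix_mul_assoc)

lemma mpow_mult: "mpow A (j * k) = mpow (mpow A j) k"
  by (induction k) (simp_all add: mpow_Suc mpow_add)

lemma mpow_Suc_right: "mpow A (Suc k) = mpow A k ** A"
  using mpow_add[of A k 1] by simp

lemma mpow_shift: "mpow (X ** Y) k ** X = X ** mpow (Y ** X) k"
proof (induction k)
  case (Suc k)
  have "mpow (X ** Y) (Suc k) ** X = X ** (Y ** (mpow (X ** Y) k ** X))"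
    by (simp only: mpow_Suc matrix_mul_assoc)
  also have "\<dots> = X ** mpow (Y ** X) (Suc k)"
    by (simp only: Suc.IH mpow_Suc matrix_mul_assoc)
  finally show ?case .
qed simp

lemma dagger_mpow: "dagger (mpow A k) = mpow (dagger A) k"
proof (induction k)
  case (Suc k)
  then show ?case
    by (simp only: mpow_Suc[of A] mpow_Suc_right[of "dagger A"] dagger_mult)
qed simp

lemma scaleR_mult_left: "(c *\<^sub>R A) ** B = c *\<^sub>R (A ** B)" for A :: "complex^'n^'m"
  by (simp add: matrix_matrix_mult_def vec_eq_iff scaleR_sum_right)

lemma scaleR_mult_right: "A ** (c *\<^sub>R B) = c *\<^sub>R (A ** B)" for A :: "complex^'n^'m"
  by (simp add: matrix_matrix_mult_def vec_eq_iff scaleR_sum_right)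

lemma mpow_scaleR: "mpow (c *\<^sub>R A) k = c ^ k *\<^sub>R mpow A k"
proof (induction k)
  case (Suc k)
  then show ?case
    by (simp only: mpow_Suc scaleR_mult_left scaleR_mult_right scaleR_scaleR power_Suc mult.commute)
qed simp

lemma retr_mult_commute: "retr (A ** B) = retr (B ** A)"
  unfolding retr_def by (subst trace_mul_sym) (rule refl)

lemma inner_eq_retr: "A \<bullet> B = retr (dagger A ** B)"
proof -
  have "retr (dagger A ** B) = (\<Sum>i\<in>UNIV. \<Sum>k\<in>UNIV. Re (cnj (A $ k $ i) * B $ k $ i))"
    by (simp add: retr_def trace_def matrix_matrix_mult_def dagger_def)
  also have "\<dots> = (\<Sum>k\<in>UNIV. \<Sum>i\<in>UNIV. Re (cnj (A $ k $ i) * B $ k $ i))"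
    by (rule sum.swap)
  also have "\<dots> = A \<bullet> B"
    by (simp add: inner_vec_def inner_complex_def)
  finally show ?thesis by simp
qed

text \<open>
  The norm of the vector type is the Frobenius norm, and Cauchy-Schwarz for each row of \<open>A\<close> and each
  column of \<open>B\<close> makes it submultiplicative.
\<close>

lemma norm_matrix_mult_le: "norm (A ** B) \<le> norm A * norm B"
  for A :: "complex^'n^'m" and B :: "complex^'k^'n"
proof -
  have entry: "norm ((A ** B) $ i $ j) \<le> norm (A $ i) * norm (dagger B $ j)" for i j
  proof -
    have "norm ((A ** B) $ i $ j) \<le> (\<Sum>k\<in>UNIV. norm (A $ i $ k) * norm (B $ k $ j))"
      by (simp add: matrix_matrix_mult_def norm_mult[symmetric] norm_sum)
    also have "\<dots> \<le> L2_set (\<lambda>k. norm (A $ i $ k)) UNIV * L2_set (\<lambda>k. norm (B $ k $ j)) UNIV"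
      using L2_set_mult_ineq[of "\<lambda>k. norm (A $ i $ k)" "\<lambda>k. norm (B $ k $ j)" UNIV]
      by simp
    finally show ?thesis by (simp add: norm_vec_def dagger_def)
  qed
  have sq: "(norm C)\<^sup>2 = (\<Sum>i\<in>UNIV. (norm (C $ i))\<^sup>2)"
    for C :: "('a::real_normed_vector)^'b"
    by (simp add: norm_vec_def L2_set_def sum_nonneg)
  have sq2: "(norm C)\<^sup>2 = (\<Sum>i\<in>UNIV. \<Sum>j\<in>UNIV. (norm (C $ i $ j))\<^sup>2)"
    for C :: "complex^'a^'b"
    by (simp add: sq)
  have nd: "norm (dagger B) = norm B"
  proof -
    have "(norm (dagger B))\<^sup>2 = (norm B)\<^sup>2"
      unfolding sq2 by (subst sum.swap) (simp add: dagger_def)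
    then show ?thesis by simp
  qed
  have "(norm (A ** B))\<^sup>2 = (\<Sum>i\<in>UNIV. \<Sum>j\<in>UNIV. (norm ((A ** B) $ i $ j))\<^sup>2)"
    by (rule sq2)
  also have "\<dots> \<le> (\<Sum>i\<in>UNIV. \<Sum>j\<in>UNIV. (norm (A $ i) * norm (dagger B $ j))\<^sup>2)"
    by (intro sum_mono power_mono entry) auto
  also have "\<dots> = (norm A * norm (dagger B))\<^sup>2"
    by (simp add: power_mult_distrib sq[of A] sq[of "dagger B"] sum_product)
  finally show ?thesis
    unfolding nd by (rule power2_le_imp_le) simp
qed

lemma matrix_mult_add_left: "(A + B) ** C = A ** C + B ** C" for A :: "complex^'n^'m"
  by (simp add: matrix_matrix_mult_def vec_eq_iff distrib_right sum.distrib)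

lemma bounded_bilinear_matrix_mult:
  "bounded_bilinear ((**) :: complex^'n^'m \<Rightarrow> complex^'k^'n \<Rightarrow> complex^'k^'m)"
proof
  show "\<exists>K. \<forall>(a :: complex^'n^'m) (b :: complex^'k^'n). norm (a ** b) \<le> norm a * norm b * K"
    by (rule exI[of _ 1]) (simp add: norm_matrix_mult_le)
qed (simp_all add: matrix_add_ldistrib matrix_mult_add_left scaleR_mult_left scaleR_mult_right)

lemmas tendsto_matrix_mult = bounded_bilinear.tendsto[OF bounded_bilinear_matrix_mult]

lemma tendsto_mpow: "(f \<longlongrightarrow> A) F \<Longrightarrow> ((\<lambda>x. mpow (f x) k) \<longlongrightarrow> mpow A k) F"
  by (induction k) (simp_all add: mpow_Suc tendsto_matrix_mult)

lemma bounded_linear_retr: "bounded_linear retr"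
  by (rule linear_linear[THEN iffD2, OF linearI])
     (simp_all add: retr_def trace_def sum.distrib sum_distrib_left)

lemma norm_mat1_sq: "(norm (mat 1 :: complex^'n^'n))\<^sup>2 = CARD('n)"
  by (simp add: power2_norm_eq_inner inner_eq_retr retr_def trace_I)

lemma retr_le_norm: "retr (A :: complex^'n^'n) \<le> norm (mat 1 :: complex^'n^'n) * norm A"
  using norm_cauchy_schwarz[of "mat 1" A] by (simp add: inner_eq_retr)

lemma norm_mpow_le: "norm (mpow (A :: complex^'n^'n) k) \<le> norm A ^ k * norm (mat 1 :: complex^'n^'n)"
proof (induction k)
  case (Suc k)
  have "norm (mpow A (Suc k)) \<le> norm A * norm (mpow A k)"
    by (simp add: mpow_Suc norm_matrix_mult_le)
  also have "\<dots> \<le> norm A * (norm A ^ k * norm (mat 1 :: complex^'n^'n))"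
    by (intro mult_left_mono Suc) simp
  finally show ?case by (simp add: mult.assoc)
qed simp

text \<open>
  The binomial theorem holds although matrices do not commute in general, since \<open>A\<close> commutes with
  the identity matrix.
\<close>

lemma mpow_one_plus:
  "mpow (mat 1 + A) n = (\<Sum>k\<le>n. of_nat (n choose k) *\<^sub>R mpow A k)"
proof (induction n)
  case (Suc n)
  let ?b = "\<lambda>n k. of_nat (n choose k) :: real"
  have "mpow (mat 1 + A) (Suc n) = (\<Sum>k\<le>n. ?b n k *\<^sub>R mpow A k) + A ** (\<Sum>k\<le>n. ?b n k *\<^sub>R mpow A k)"
    by (simp add: mpow_Suc matrix_mult_add_left Suc.IH)
  also have "A ** (\<Sum>k\<le>n. ?b n k *\<^sub>R mpow A k) = (\<Sum>k\<le>n. ?b n k *\<^sub>R mpow A (Suc k))"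
    by (simp add: bounded_bilinear.sum_right[OF bounded_bilinear_matrix_mult] scaleR_mult_right mpow_Suc)
  also have "(\<Sum>k\<le>n. ?b n k *\<^sub>R mpow A k) = (\<Sum>k\<le>Suc n. ?b n k *\<^sub>R mpow A k)"
    by simp
  also have "\<dots> = mat 1 + (\<Sum>k\<le>n. ?b n (Suc k) *\<^sub>R mpow A (Suc k))"
    by (simp only: sum.atMost_Suc_shift) simp
  also have "\<dots> + (\<Sum>k\<le>n. ?b n k *\<^sub>R mpow A (Suc k))
      = mat 1 + (\<Sum>k\<le>n. ?b (Suc n) (Suc k) *\<^sub>R mpow A (Suc k))"
    by (simp add: sum.distrib scaleR_left_distrib add.commute add.left_commute)
  also have "\<dots> = (\<Sum>k\<le>Suc n. ?b (Suc n) k *\<^sub>R mpow A k)"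
    by (simp only: sum.atMost_Suc_shift) simp
  finally show ?case .
qed simp

lemma binomial_over_power_tendsto:
  "(\<lambda>n. real (n choose k) * (1 / real n) ^ k) \<longlonglongrightarrow> 1 / fact k"
proof (rule Lim_transform_eventually)
  have "(\<lambda>n. (\<Prod>i<k. 1 - real i * (1 / real n)) / fact k) \<longlonglongrightarrow> (\<Prod>i<k. 1 - real i * 0) / fact k"
    by (intro tendsto_intros lim_1_over_n) simp
  then show "(\<lambda>n. (\<Prod>i<k. 1 - real i * (1 / real n)) / fact k) \<longlonglongrightarrow> 1 / fact k"
    by simp
  show "\<forall>\<^sub>F n in sequentially. (\<Prod>i<k. 1 - real i * (1 / real n)) / fact k
      = real (n choose k) * (1 / real n) ^ k"
    using eventually_gt_at_top[of 0]
  proof eventually_elim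
    case (elim n)
    have "(\<Prod>i<k. 1 - real i * (1 / real n)) = (\<Prod>i<k. (real n - real i) * (1 / real n))"
      using elim by (intro prod.cong) (auto simp: field_simps)
    also have "\<dots> = (\<Prod>i<k. real n - real i) * (1 / real n) ^ k"
      by (simp only: prod.distrib prod_constant card_lessThan)
    finally show ?case
      by (simp add: binomial_gbinomial gbinomial_prod_rev atLeast0LessThan)
  qed
qed

lemma binomial_over_power_le: "real (n choose k) * (1 / real n) ^ k \<le> 1 / fact k"
proof (cases "n = 0")
  case False
  have "(n choose k) * fact k \<le> n ^ k"
    using binomial_fact_pow by simp
  then have "real (n choose k) * fact k \<le> real n ^ k"
    by (metis of_nat_fact of_nat_le_iff of_nat_mult of_nat_power)
  then show ?thesis using False by (simp add: field_simps)
qed (cases k; simp)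

lemma summable_mat_exp: "summable (\<lambda>k. (1 / fact k) *\<^sub>R mpow A k)"
  for A :: "complex^'n^'n"
proof (rule summable_comparison_test')
  show "summable (\<lambda>k. (norm A ^ k / fact k) * norm (mat 1 :: complex^'n^'n))"
    using summable_exp[of "norm A"] by (intro summable_mult2) (simp add: field_simps)
  show "norm ((1 / fact k) *\<^sub>R mpow A k) \<le> (norm A ^ k / fact k) * norm (mat 1 :: complex^'n^'n)" for k
    using divide_right_mono[OF norm_mpow_le[of A k], of "fact k"] by simp
qed

lemma mat_exp_alt: "mat_exp A = (\<Sum>k. (1 / fact k) *\<^sub>R mpow A k)"
  by (simp add: mat_exp_def mpow_def)

lemma norm_entry_le: "norm (A $ i $ j) \<le> norm A" for A :: "complex^'n^'m"
  by (meson Finite_Cartesian_Product.norm_nth_le order_trans)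

text \<open>
  The \<open>k\<close>-th term of the binomial expansion tends to the \<open>k\<close>-th term of the exponential series and is
  dominated by a term of a convergent series uniformly in \<open>n\<close>; Tannery's theorem exchanges limit and
  sum.  Allowing \<open>C n\<close> to vary with \<open>n\<close> is what makes the lemma applicable to the product
  \<open>(1 + A / n) (1 + B / n) = 1 + (A + B + A B / n) / n\<close>.
\<close>

lemma mat_exp_limit:
  fixes C :: "nat \<Rightarrow> complex^'n^'n"
  assumes lim: "C \<longlonglongrightarrow> A"
  shows "(\<lambda>n. mpow (mat 1 + (1 / real n) *\<^sub>R C n) n) \<longlonglongrightarrow> mat_exp A"
proof (intro vec_tendstoI)
  fix i j :: 'n
  obtain R where R: "\<And>n. norm (C n) \<le> R"
    using Bseq_def convergent_imp_Bseq convergentI[OF lim] by metis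
  let ?N = "norm (mat 1 :: complex^'n^'n)"
  let ?b = "\<lambda>n k. real (n choose k) * (1 / real n) ^ k"
  define a where "a k n = (?b n k *\<^sub>R mpow (C n) k) $ i $ j" for k n
  have "(\<lambda>n. \<Sum>k. a k n) \<longlonglongrightarrow> (\<Sum>k. ((1 / fact k) *\<^sub>R mpow A k) $ i $ j)"
    \<comment> \<open>Convergence of matrices is convergence of the entries, to each of which Tannery's theorem applies.\<close>
  proof (rule tannerys_theorem[THEN conjunct2, THEN conjunct2])
    show "(\<lambda>n. a k n) \<longlonglongrightarrow> ((1 / fact k) *\<^sub>R mpow A k) $ i $ j" for k
      unfolding a_def
      by (intro tendsto_vec_nth tendsto_scaleR binomial_over_power_tendsto tendsto_mpow lim)
    show "summable (\<lambda>k. (R ^ k / fact k) * ?N)"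
      using summable_exp[of R] by (intro summable_mult2) (simp add: field_simps)
    have "norm (a k n) \<le> (R ^ k / fact k) * ?N" for k n
    proof -
      have "norm (a k n) \<le> norm (?b n k *\<^sub>R mpow (C n) k)"
        unfolding a_def by (rule norm_entry_le)
      also have "\<dots> = ?b n k * norm (mpow (C n) k)" by simp
      also have "\<dots> \<le> (1 / fact k) * (norm (C n) ^ k * ?N)"
        by (intro mult_mono binomial_over_power_le norm_mpow_le) auto
      also have "\<dots> \<le> (1 / fact k) * (R ^ k * ?N)"
        by (intro mult_left_mono mult_right_mono power_mono R) auto
      finally show ?thesis by simp
    qed
    then show "\<forall>\<^sub>F (k, n) in sequentially \<times>\<^sub>F sequentially. norm (a k n) \<le> (R ^ k / fact k) * ?N"
      by (intro always_eventually) auto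
  qed simp
  moreover have "(\<Sum>k. a k n) = mpow (mat 1 + (1 / real n) *\<^sub>R C n) n $ i $ j" for n
  proof -
    have "(\<Sum>k. a k n) = (\<Sum>k\<le>n. a k n)"
      by (rule suminf_finite) (auto simp: a_def)
    then show ?thesis
      by (simp add: a_def mpow_one_plus mpow_scaleR)
  qed
  moreover have "(\<Sum>k. ((1 / fact k) *\<^sub>R mpow A k) $ i $ j) = mat_exp A $ i $ j"
    unfolding mat_exp_alt
    by (subst bounded_linear.suminf[OF bounded_linear_vec_nth summable_mat_exp])
       (subst bounded_linear.suminf[OF bounded_linear_vec_nth], 
        rule bounded_linear.summable[OF bounded_linear_vec_nth summable_mat_exp], rule refl)
  ultimately show "(\<lambda>n. mpow (mat 1 + (1 / real n) *\<^sub>R C n) n $ i $ j) \<longlonglongrightarrow> mat_exp A $ i $ j"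
    by simp
qed

section \<open>The Golden-Thompson inequality\<close>

primrec mprod :: "(nat \<Rightarrow> complex^'n^'n) \<Rightarrow> nat \<Rightarrow> complex^'n^'n" where
  "mprod Z 0 = mat 1"
| "mprod Z (Suc n) = mprod Z n ** Z n"

lemma mprod_const: "mprod (\<lambda>_. A) n = mpow A n"
  by (induction n) (simp_all add: mpow_Suc_right)

lemma mprod_pairs: "mprod Z (2 * n) = mprod (\<lambda>i. Z (2 * i) ** Z (2 * i + 1)) n"
  by (induction n) (simp_all add: matrix_mul_assoc)

lemma prod_pairs: "(\<Prod>i<2 * n. f i) = (\<Prod>i<n. f (2 * i) * f (2 * i + 1))"
  for f :: "nat \<Rightarrow> 'a::comm_monoid_mult"
  by (induction n) (simp_all add: mult.assoc)

lemma mpow_square: "mpow A 2 = A ** A"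
  by (simp add: numeral_2_eq_2 mpow_Suc)

text \<open>
  This is \<open>\<parallel>Z\<parallel>\<^sub>p\<^sup>p\<close>, the \<open>p\<close>-th power of the Schatten norm, for \<open>p = 2\<^bsup>k + 1\<^esup>\<close>.
\<close>

definition schatten :: "nat \<Rightarrow> complex^'n^'n \<Rightarrow> real" where
  "schatten k Z = retr (mpow (dagger Z ** Z) (2 ^ k))"

lemma retr_mpow_commute: "retr (mpow (X ** Y) k) = retr (mpow (Y ** X) k)"
  for X Y :: "complex^'n^'n"
proof (cases k)
  case (Suc j)
  have "retr (mpow (X ** Y) (Suc j)) = retr ((mpow (X ** Y) j ** X) ** Y)"
    by (simp only: mpow_Suc_right matrix_mul_assoc)
  also have "\<dots> = retr (mpow (Y ** X) (Suc j))"
    unfolding mpow_shift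
    by (subst retr_mult_commute) (simp only: mpow_Suc matrix_mul_assoc)
  finally show ?thesis using Suc by simp
qed simp

lemma schatten_nonneg: "0 \<le> schatten k Z"
proof (cases k)
  case 0
  then show ?thesis by (simp add: schatten_def inner_eq_retr[symmetric])
next
  case (Suc j)
  let ?P = "mpow (dagger Z ** Z) (2 ^ j)"
  have "dagger ?P = ?P" by (simp add: dagger_mpow dagger_mult)
  then have "schatten k Z = ?P \<bullet> ?P"
    by (simp add: schatten_def Suc inner_eq_retr mpow_add[symmetric] mult_2)
  then show ?thesis by simp
qed

lemma schatten_dagger: "schatten k (dagger Z) = schatten k Z"
  by (simp add: schatten_def retr_mpow_commute)

lemma schatten_gram: "schatten k (dagger Z ** Z) = schatten (Suc k) Z"
  by (simp add: schatten_def dagger_mult mpow_mult mpow_square)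

text \<open>
  Hoelder's inequality for \<open>p\<close> factors in the Schatten norm with \<open>p = 2\<^bsup>k + 1\<^esup>\<close>, raised to the
  power \<open>p\<close>.  For \<open>k = 0\<close> it is Cauchy-Schwarz.  For the induction step the \<open>2 p\<close> factors are grouped
  into \<open>p\<close> pairs \<open>X Y\<close>.  The Schatten norm of such a pair is the trace of the alternating product of
  \<open>P = X\<^sup>* X\<close> and \<open>Q = Y Y\<^sup>*\<close> with \<open>p\<close> factors, so the induction hypothesis applies to it a second
  time and bounds it through the norms of \<open>P\<close> and \<open>Q\<close>, that is through the norms of \<open>X\<close> and \<open>Y\<close>
  with exponent \<open>2 p\<close>.
\<close>

lemma schatten_hoelder:
  fixes Z :: "nat \<Rightarrow> complex^'n^'n"
  shows
  "\<bar>retr (mprod Z (2 ^ Suc k))\<bar> ^ (2 ^ Suc k) \<le> (\<Prod>i<2 ^ Suc k. schatten k (Z i))"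
proof (induction k arbitrary: Z)
  case 0
  have "\<bar>retr (Z 0 ** Z 1)\<bar> = \<bar>dagger (Z 0) \<bullet> Z 1\<bar>"
    by (simp add: inner_eq_retr)
  also have "\<dots> \<le> norm (dagger (Z 0)) * norm (Z 1)"
    by (rule Cauchy_Schwarz_ineq2)
  finally have "\<bar>retr (Z 0 ** Z 1)\<bar>\<^sup>2 \<le> (norm (dagger (Z 0)) * norm (Z 1))\<^sup>2"
    by (rule power_mono) simp
  also have "\<dots> = schatten 0 (dagger (Z 0)) * schatten 0 (Z 1)"
    by (simp add: power_mult_distrib power2_norm_eq_inner inner_eq_retr schatten_def)
  also have "\<dots> = schatten 0 (Z 0) * schatten 0 (Z 1)"
    by (simp only: schatten_dagger)
  finally show ?case
    by (simp add: numeral_2_eq_2)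
next
  case (Suc k)
  have prod2: "(schatten k (X ** Y))\<^sup>2 \<le> schatten (Suc k) X * schatten (Suc k) Y"
    for X Y :: "complex^'n^'n"
  proof -
    define P Q where "P = dagger X ** X" and "Q = Y ** dagger Y"
    define n :: nat where "n = 2 ^ k"
    have n: "n \<noteq> 0" by (simp add: n_def)
    let ?R = "\<lambda>i::nat. if even i then P else Q"
    have "schatten k (X ** Y) = retr (mpow (dagger Y ** (dagger X ** X ** Y)) n)"
      by (simp add: schatten_def n_def dagger_mult matrix_mul_assoc)
    also have "\<dots> = retr (mpow (P ** Q) n)"
      by (subst retr_mpow_commute) (simp add: P_def Q_def matrix_mul_assoc)
    also have "mpow (P ** Q) n = mprod ?R (2 ^ Suc k)"
      using mprod_pairs[of ?R n] by (simp add: mprod_const n_def)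
    finally have "\<bar>schatten k (X ** Y)\<bar> ^ (2 ^ Suc k) \<le> (\<Prod>i<2 ^ Suc k. schatten k (?R i))"
      using Suc.IH[of ?R] by simp
    also have "\<dots> = (schatten k P * schatten k Q) ^ n"
      using prod_pairs[of "\<lambda>i. schatten k (?R i)" n] by (simp add: n_def)
    finally have "((schatten k (X ** Y))\<^sup>2) ^ n \<le> (schatten k P * schatten k Q) ^ n"
      by (simp add: n_def schatten_nonneg flip: power_mult)
    then have "(schatten k (X ** Y))\<^sup>2 \<le> schatten k P * schatten k Q"
      using n by (subst (asm) power_mono_iff) (simp_all add: schatten_nonneg)
    also have "schatten k P = schatten (Suc k) X"
      by (simp only: P_def schatten_gram)
    also have "schatten k Q = schatten (Suc k) Y"
      using schatten_gram[of k "dagger Y"] by (simp only: Q_def dagger_dagger schatten_dagger)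
    finally show ?thesis .
  qed
  let ?W = "\<lambda>i. Z (2 * i) ** Z (2 * i + 1)"
  have "\<bar>retr (mprod Z (2 ^ Suc (Suc k)))\<bar> ^ (2 ^ Suc (Suc k))
      = (\<bar>retr (mprod ?W (2 ^ Suc k))\<bar> ^ (2 ^ Suc k))\<^sup>2"
    using mprod_pairs[of Z "2 ^ Suc k"]
    by (simp only: power_Suc[of 2 "Suc k"] mult.commute[of 2] flip: power_mult)
  also have "\<dots> \<le> (\<Prod>i<2 ^ Suc k. schatten k (?W i))\<^sup>2"
    by (intro power_mono Suc.IH) simp
  also have "\<dots> = (\<Prod>i<2 ^ Suc k. (schatten k (?W i))\<^sup>2)"
    by (simp only: prod_power_distrib)
  also have "\<dots> \<le> (\<Prod>i<2 ^ Suc k. schatten (Suc k) (Z (2 * i)) * schatten (Suc k) (Z (2 * i + 1)))"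
    by (intro prod_mono conjI prod2) simp
  also have "\<dots> = (\<Prod>i<2 ^ Suc (Suc k). schatten (Suc k) (Z i))"
    using prod_pairs[of "\<lambda>i. schatten (Suc k) (Z i)" "2 ^ Suc k"] by simp
  finally show ?case .
qed

lemma retr_mpow_le_schatten: "retr (mpow Z (2 ^ Suc k)) \<le> schatten k Z"
proof -
  have "\<bar>retr (mpow Z (2 ^ Suc k))\<bar> ^ (2 ^ Suc k) \<le> schatten k Z ^ (2 ^ Suc k)"
    using schatten_hoelder[of "\<lambda>_. Z" k] by (simp add: mprod_const)
  then have "\<bar>retr (mpow Z (2 ^ Suc k))\<bar> \<le> schatten k Z"
    by (subst (asm) power_mono_iff) (simp_all add: schatten_nonneg)
  then show ?thesis by simp
qed

text \<open>
  Each step replaces \<open>(X, Y)\<close> by \<open>(X\<^sup>2, Y\<^sup>2)\<close>: since \<open>(X Y)\<^sup>* (X Y) = Y X\<^sup>2 Y\<close>, cyclicity of the trace turns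
  the Schatten norm of \<open>X Y\<close> into the trace of a power of \<open>X\<^sup>2 Y\<^sup>2\<close>.
\<close>

lemma retr_mpow_mult_le:
  assumes "dagger X = X" "dagger Y = Y"
  shows "retr (mpow (X ** Y) (2 ^ k)) \<le> retr (mpow X (2 ^ k) ** mpow Y (2 ^ k))"
  using assms
proof (induction k arbitrary: X Y)
  case (Suc k)
  have "retr (mpow (X ** Y) (2 ^ Suc k)) \<le> schatten k (X ** Y)"
    by (rule retr_mpow_le_schatten)
  also have "\<dots> = retr (mpow (Y ** (X ** X ** Y)) (2 ^ k))"
    by (simp add: schatten_def dagger_mult Suc.prems matrix_mul_assoc)
  also have "\<dots> = retr (mpow ((X ** X) ** (Y ** Y)) (2 ^ k))"
    by (subst retr_mpow_commute) (simp add: matrix_mul_assoc)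
  also have "\<dots> \<le> retr (mpow (X ** X) (2 ^ k) ** mpow (Y ** Y) (2 ^ k))"
    by (rule Suc.IH) (simp_all add: dagger_mult Suc.prems)
  also have "\<dots> = retr (mpow X (2 ^ Suc k) ** mpow Y (2 ^ Suc k))"
    by (simp add: mpow_mult mpow_square)
  finally show ?case .
qed simp

text \<open>
  The inequality \<open>retr_mpow_mult_le\<close> for \<open>X = 1 + A / n\<close> and \<open>Y = 1 + B / n\<close>, in the limit along
  \<open>n = 2\<^sup>k\<close>.
\<close>

theorem golden_thompson:
  assumes A: "dagger A = A" and B: "dagger B = B"
  shows "retr (mat_exp (A + B)) \<le> retr (mat_exp A ** mat_exp B)"
proof -
  let ?e = "\<lambda>n C. mat 1 + (1 / real n) *\<^sub>R C"
  have sub: "strict_mono (\<lambda>k::nat. (2::nat) ^ k)"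
    by (simp add: strict_mono_def)
  note tr = bounded_linear.tendsto[OF bounded_linear_retr]
  have "(\<lambda>n. A + B + (1 / real n) *\<^sub>R (A ** B)) \<longlonglongrightarrow> A + B + 0 *\<^sub>R (A ** B)"
    by (intro tendsto_intros lim_1_over_n)
  then have "(\<lambda>n. retr (mpow (?e n (A + B + (1 / real n) *\<^sub>R (A ** B))) n)) \<longlonglongrightarrow> retr (mat_exp (A + B))"
    by (intro tr mat_exp_limit) simp
  moreover have "?e n (A + B + (1 / real n) *\<^sub>R (A ** B)) = ?e n A ** ?e n B" for n
    by (simp add: matrix_mult_add_left matrix_add_ldistrib scaleR_mult_left scaleR_mult_right
        scaleR_add_right)
  ultimately have L: "(\<lambda>n. retr (mpow (?e n A ** ?e n B) n)) \<longlonglongrightarrow> retr (mat_exp (A + B))"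
    by simp
  have R: "(\<lambda>n. retr (mpow (?e n A) n ** mpow (?e n B) n)) \<longlonglongrightarrow> retr (mat_exp A ** mat_exp B)"
    by (intro tr tendsto_matrix_mult mat_exp_limit tendsto_const)
  show ?thesis
  proof (rule LIMSEQ_le[OF LIMSEQ_subseq_LIMSEQ[OF L sub] LIMSEQ_subseq_LIMSEQ[OF R sub]])
    show "\<exists>N. \<forall>k\<ge>N. ((\<lambda>n. retr (mpow (?e n A ** ?e n B) n)) \<circ> (\<lambda>k. 2 ^ k)) k
        \<le> ((\<lambda>n. retr (mpow (?e n A) n ** mpow (?e n B) n)) \<circ> (\<lambda>k. 2 ^ k)) k"
      unfolding o_def
      by (intro exI allI impI retr_mpow_mult_le) (simp_all add: dagger_add dagger_scaleR A B)
  qed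
qed

section \<open>Bounds and symmetries of the matrix exponential\<close>

lemma mpow_mat1 [simp]: "mpow (mat 1) k = mat 1"
  by (induction k) (simp_all add: mpow_Suc)

lemma mat_exp_0 [simp]: "mat_exp 0 = mat 1"
  using LIMSEQ_unique[OF mat_exp_limit[OF tendsto_const[of 0]], of "mat 1"] by simp

lemma mat_exp_double: "mat_exp (2 *\<^sub>R A) = mat_exp A ** mat_exp A"
proof (rule LIMSEQ_unique)
  let ?X = "\<lambda>n. mpow (mat 1 + (1 / real n) *\<^sub>R A) n"
  show "(\<lambda>n. ?X n ** ?X n) \<longlonglongrightarrow> mat_exp A ** mat_exp A"
    by (intro tendsto_matrix_mult mat_exp_limit tendsto_const)
  have "strict_mono (\<lambda>n::nat. n * 2)"
    by (simp add: strict_mono_def)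
  from LIMSEQ_subseq_LIMSEQ[OF mat_exp_limit[OF tendsto_const[of "2 *\<^sub>R A"]] this]
  show "(\<lambda>n. ?X n ** ?X n) \<longlonglongrightarrow> mat_exp (2 *\<^sub>R A)"
    by (simp add: o_def mpow_mult mpow_square)
qed

text \<open>
  Such a map sends \<open>(1 + A / n)\<^sup>n\<close> to \<open>(1 + \<Phi> A / n)\<^sup>n\<close>, and being linear in finite dimension it is
  continuous.  Conjugations are maps of this kind.
\<close>

lemma mat_exp_hom:
  fixes \<Phi> :: "complex^'n^'n \<Rightarrow> complex^'n^'n"
  assumes lin: "linear \<Phi>" and mult: "\<And>X Y. \<Phi> (X ** Y) = \<Phi> X ** \<Phi> Y" and one: "\<Phi> (mat 1) = mat 1"
  shows "\<Phi> (mat_exp A) = mat_exp (\<Phi> A)"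
proof (rule LIMSEQ_unique)
  have pow: "\<Phi> (mpow X k) = mpow (\<Phi> X) k" for X k
    by (induction k) (simp_all add: mpow_Suc mult one)
  have "(\<lambda>n. \<Phi> (mpow (mat 1 + (1 / real n) *\<^sub>R A) n)) \<longlonglongrightarrow> \<Phi> (mat_exp A)"
    using lin by (intro bounded_linear.tendsto[of \<Phi>] mat_exp_limit tendsto_const)
      (simp add: linear_linear)
  then show "(\<lambda>n. mpow (mat 1 + (1 / real n) *\<^sub>R \<Phi> A) n) \<longlonglongrightarrow> \<Phi> (mat_exp A)"
    by (simp add: pow linear_add[OF lin] linear_scale[OF lin] one)
  show "(\<lambda>n. mpow (mat 1 + (1 / real n) *\<^sub>R \<Phi> A) n) \<longlonglongrightarrow> mat_exp (\<Phi> A)"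
    by (intro mat_exp_limit tendsto_const)
qed

lemma linear_dagger: "linear (dagger :: complex^'n^'m \<Rightarrow> complex^'m^'n)"
  by (rule linearI) (simp_all add: dagger_add dagger_scaleR)

lemma dagger_mat_exp:
  assumes "dagger A = A"
  shows "dagger (mat_exp A) = mat_exp A"
proof (rule LIMSEQ_unique)
  have "(\<lambda>n. dagger (mpow (mat 1 + (1 / real n) *\<^sub>R A) n)) \<longlonglongrightarrow> dagger (mat_exp A)"
    using linear_dagger by (intro bounded_linear.tendsto[of dagger] mat_exp_limit tendsto_const)
      (simp add: linear_linear)
  then show "(\<lambda>n. mpow (mat 1 + (1 / real n) *\<^sub>R A) n) \<longlonglongrightarrow> dagger (mat_exp A)"
    by (simp add: dagger_mpow dagger_add dagger_scaleR assms)
  show "(\<lambda>n. mpow (mat 1 + (1 / real n) *\<^sub>R A) n) \<longlonglongrightarrow> mat_exp A"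
    by (intro mat_exp_limit tendsto_const)
qed

lemma trace_hermitian:
  assumes "dagger A = A"
  shows "trace A = complex_of_real (retr A)"
proof -
  have "cnj (A $ i $ i) = A $ i $ i" for i
    using arg_cong[OF assms, of "\<lambda>X. X $ i $ i"] by (simp add: dagger_def)
  then have "cnj (trace A) = trace A"
    by (simp add: trace_def)
  then show ?thesis
    by (simp add: retr_def complex_eq_iff)
qed

lemma retr_mat_exp_le:
  fixes A :: "complex^'n^'n"
  shows "retr (mat_exp A) \<le> CARD('n) * exp (norm A)"
proof -
  let ?N = "norm (mat 1 :: complex^'n^'n)"
  have "norm (mat_exp A) \<le> (\<Sum>k. (norm A ^ k / fact k) * ?N)"
    unfolding mat_exp_alt
  proof (rule norm_suminf_le)
    show "summable (\<lambda>k. (norm A ^ k / fact k) * ?N)"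
      using summable_exp[of "norm A"] by (intro summable_mult2) (simp add: field_simps)
    show "norm ((1 / fact k) *\<^sub>R mpow A k) \<le> (norm A ^ k / fact k) * ?N" for k
      using divide_right_mono[OF norm_mpow_le[of A k], of "fact k"] by simp
  qed
  also have "\<dots> = exp (norm A) * ?N"
    using summable_exp[of "norm A"]
    by (subst suminf_mult2[symmetric]) (simp_all add: exp_def field_simps)
  finally have "?N * norm (mat_exp A) \<le> ?N * (exp (norm A) * ?N)"
    by (rule mult_left_mono) simp
  then have "retr (mat_exp A) \<le> ?N\<^sup>2 * exp (norm A)"
    using retr_le_norm[of "mat_exp A"] by (simp add: power2_eq_square mult_ac)
  then show ?thesis by (simp add: norm_mat1_sq)
qed

text \<open>
  Golden-Thompson for \<open>A / 2\<close> and \<open>- A / 2\<close>, followed by Cauchy-Schwarz, gives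
  \<open>N\<^sup>2 \<le> Tr (exp A) Tr (exp (- A))\<close>; the second factor is bounded above by the preceding lemma.
\<close>

lemma retr_mat_exp_ge:
  fixes A :: "complex^'n^'n"
  assumes "dagger A = A"
  shows "CARD('n) * exp (- norm A) \<le> retr (mat_exp A)"
proof -
  let ?N = "real CARD('n)"
  define B where "B = (1/2) *\<^sub>R A"
  have B: "dagger B = B" "dagger (- B) = - B"
    using assms dagger_scaleR[of "-1" B] by (simp_all add: B_def dagger_scaleR)
  have sq: "(norm (mat_exp C))\<^sup>2 = retr (mat_exp (2 *\<^sub>R C))" if "dagger C = C" for C :: "complex^'n^'n"
    using that by (simp add: power2_norm_eq_inner inner_eq_retr dagger_mat_exp mat_exp_double)
  have "?N \<le> retr (mat_exp B ** mat_exp (- B))"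
    using golden_thompson[OF B] by (simp add: retr_def trace_I)
  also have "\<dots> = mat_exp B \<bullet> mat_exp (- B)"
    by (simp add: inner_eq_retr dagger_mat_exp B)
  also have "\<dots> \<le> norm (mat_exp B) * norm (mat_exp (- B))"
    by (rule norm_cauchy_schwarz)
  finally have "?N\<^sup>2 \<le> (norm (mat_exp B) * norm (mat_exp (- B)))\<^sup>2"
    by (rule power_mono) simp
  also have "\<dots> = retr (mat_exp A) * retr (mat_exp (- A))"
    using sq[OF B(1)] sq[OF B(2)] by (simp add: power_mult_distrib B_def)
  also have "\<dots> \<le> retr (mat_exp A) * (?N * exp (norm A))"
  proof (rule mult_left_mono)
    show "retr (mat_exp (- A)) \<le> ?N * exp (norm A)"
      using retr_mat_exp_le[of "- A"] by simp
    show "0 \<le> retr (mat_exp A)"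
      using sq[OF B(1)] zero_le_power2[of "norm (mat_exp B)"] by (simp add: B_def)
  qed
  finally have "?N * ?N \<le> ?N * (retr (mat_exp A) * exp (norm A))"
    by (simp add: power2_eq_square mult_ac)
  then have "?N \<le> retr (mat_exp A) * exp (norm A)"
    by simp
  then show ?thesis
    by (simp add: exp_minus field_simps)
qed

lemma retr_mat_exp_pos:
  assumes "dagger A = A"
  shows "0 < retr (mat_exp A)"
proof (rule less_le_trans[OF _ retr_mat_exp_ge[OF assms]])
qed simp

lemma abs_ln_retr_mat_exp_le:
  fixes A :: "complex^'n^'n"
  assumes "dagger A = A"
  shows "\<bar>ln (retr (mat_exp A) / CARD('n))\<bar> \<le> norm A"
proof -
  let ?r = "retr (mat_exp A) / CARD('n)"
  have pos: "0 < ?r" using retr_mat_exp_pos[OF assms] by simp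
  have "exp (- norm A) \<le> ?r" "?r \<le> exp (norm A)"
    using retr_mat_exp_ge[OF assms] retr_mat_exp_le[of A] by (simp_all add: field_simps)
  then have "exp (- norm A) \<le> exp (ln ?r)" "exp (ln ?r) \<le> exp (norm A)"
    by (simp_all only: exp_ln[OF pos])
  then have "- norm A \<le> ln ?r" "ln ?r \<le> norm A"
    by (simp_all only: exp_le_cancel_iff)
  then show ?thesis by (intro abs_leI) linarith+
qed

text \<open>
  Jensen's inequality for the logarithm, from its tangent at the mean \<open>c\<close>.
\<close>

lemma sum_ln_le:
  fixes y :: "'a \<Rightarrow> real"
  assumes fin: "finite I" and pos: "\<And>u. u \<in> I \<Longrightarrow> 0 < y u" and sum: "(\<Sum>u\<in>I. y u) = real (card I) * c"
    and c: "0 < c"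
  shows "(\<Sum>u\<in>I. ln (y u)) \<le> real (card I) * ln c"
proof -
  have "(\<Sum>u\<in>I. ln (y u)) \<le> (\<Sum>u\<in>I. ln c + (y u / c - 1))"
  proof (rule sum_mono)
    fix u assume u: "u \<in> I"
    have "ln (y u / c) \<le> y u / c - 1"
      using pos[OF u] c by (intro ln_le_minus_one) simp
    then show "ln (y u) \<le> ln c + (y u / c - 1)"
      using pos[OF u] c by (simp add: ln_div)
  qed
  also have "\<dots> = real (card I) * ln c"
    using sum c by (simp add: sum.distrib sum_subtractf flip: sum_divide_distrib)
  finally show ?thesis .
qed

section \<open>Averaging over the Pauli group\<close>

text \<open>
  The eigenvalue of \<open>\<sigma>\<^sup>z\<close> at a basis vector.  The type \<open>2\<close> has the elements \<open>1\<close> and \<open>2\<close>, which index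
  the first and the second basis vector.
\<close>

definition spin :: "2 \<Rightarrow> real" where
  "spin a = (if a = 1 then 1 else -1)"

definition flips :: "'m set \<Rightarrow> ('m \<Rightarrow> 2) \<Rightarrow> 'm \<Rightarrow> 2" where
  "flips T s = (\<lambda>i. if i \<in> T then (if s i = 1 then 2 else 1) else s i)"

definition parity :: "'m set \<Rightarrow> ('m \<Rightarrow> 2) \<Rightarrow> real" where
  "parity S s = (\<Prod>i\<in>S. spin (s i))"

text \<open>
  Conjugation of \<open>X\<close> by the product of the \<open>\<sigma>\<^sup>z\<^sub>i\<close> with \<open>i \<in> S\<close> and the \<open>\<sigma>\<^sup>x\<^sub>i\<close> with \<open>i \<in> T\<close>.  The former
  multiply the basis vector \<open>s\<close> by \<open>parity S s\<close>, the latter permute the basis by \<open>flips T\<close>, so the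
  conjugation is a signed permutation of the entries.
\<close>

definition twist :: "'m::finite set \<Rightarrow> 'm set \<Rightarrow> 'm op \<Rightarrow> 'm op" where
  "twist S T X = (\<chi> s t. (parity S s * parity S t) *\<^sub>R X $ flips T s $ flips T t)"

lemma spin_sq [simp]: "spin a * spin a = 1"
  by (simp add: spin_def)

lemma spin_mult: "spin a * spin b = (if a = b then 1 else -1)"
  using exhaust_2[of a] exhaust_2[of b] by (auto simp: spin_def)

lemma parity_sq [simp]: "parity S s * parity S s = 1"
  by (simp add: parity_def flip: prod.distrib)

lemma flips_flips [simp]: "flips T (flips T s) = s"
proof
  show "flips T (flips T s) i = s i" for i
    using exhaust_2[of "s i"] by (auto simp: flips_def)
qed

lemma flips_eq_iff: "flips T s = flips T t \<longleftrightarrow> s = t"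
  by (rule inj_eq[OF inj_on_inverseI[of UNIV "flips T"]]) simp

lemma flips_commute: "flips S (flips T s) = flips T (flips S s)"
  by (auto simp: flips_def)

lemma sum_flips: "(\<Sum>s\<in>UNIV. f (flips T s)) = (\<Sum>s\<in>UNIV. f s)" for f :: "('m::finite \<Rightarrow> 2) \<Rightarrow> 'a::comm_monoid_add"
  by (rule sum.reindex_bij_witness[of _ "flips T" "flips T"]) auto

text \<open>
  Every configuration \<open>t\<close> arises from \<open>s\<close> by flipping exactly the sites where they differ.
\<close>

lemma sum_flips_sets: "(\<Sum>T\<in>UNIV. f (flips T s)) = (\<Sum>t\<in>UNIV. f t)" for f :: "('m::finite \<Rightarrow> 2) \<Rightarrow> 'a::comm_monoid_add"
proof (rule sum.reindex_bij_witness[of _ "\<lambda>t. {i. t i \<noteq> s i}" "\<lambda>T. flips T s"])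
  show "{i. flips T s i \<noteq> s i} = T" for T
    by (auto simp: flips_def)
  show "flips {i. t i \<noteq> s i} s = t" for t
  proof
    show "flips {i. t i \<noteq> s i} s i = t i" for i
      using exhaust_2[of "s i"] exhaust_2[of "t i"] by (auto simp: flips_def)
  qed
qed auto

text \<open>
  Orthogonality of characters: the sum over all \<open>S\<close> is the expansion of
  \<open>\<Prod>i. (1 + spin (s i) * spin (t i))\<close>, whose factors are \<open>2\<close> or \<open>0\<close>.
\<close>

lemma sum_parity: 
  "(\<Sum>S\<in>UNIV. parity S s * parity S t) = (if s = t then 2 ^ CARD('m) else 0)"
  for s t :: "'m::finite \<Rightarrow> 2"
proof -
  have "(\<Prod>i\<in>UNIV. spin (s i) * spin (t i) + 1)
      = (\<Sum>S\<in>Pow UNIV. (\<Prod>i\<in>S. spin (s i) * spin (t i)) * (\<Prod>i\<in>UNIV - S. 1))"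
    by (rule prod_add) simp
  then have "(\<Sum>S\<in>UNIV. parity S s * parity S t) = (\<Prod>i\<in>UNIV. spin (s i) * spin (t i) + 1)"
    by (simp add: parity_def prod.distrib)
  also have "\<dots> = (if s = t then 2 ^ CARD('m) else 0)"
    by (auto simp: spin_mult fun_eq_iff)
  finally show ?thesis .
qed

lemma linear_twist: "linear (twist S T)"
  by (rule linearI) (simp_all add: twist_def vec_eq_iff scaleR_add_right)

lemma twist_mat1: "twist S T (mat 1) = mat 1"
  by (simp add: twist_def vec_eq_iff mat_def flips_eq_iff)

lemma twist_mult: "twist S T (X ** Y) = twist S T X ** twist S T Y"
proof -
  have "(twist S T X ** twist S T Y) $ s $ t = twist S T (X ** Y) $ s $ t" for s t
  proof -
    have "(parity S s * parity S u) *\<^sub>R X $ flips T s $ flips T u *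
        (parity S u * parity S t) *\<^sub>R Y $ flips T u $ flips T t
      = (parity S s * parity S t) *\<^sub>R (X $ flips T s $ flips T u * Y $ flips T u $ flips T t)" for u
    proof -
      have "parity S u * parity S t * (parity S s * parity S u)
          = (parity S u * parity S u) * (parity S s * parity S t)"
        by (simp only: mult_ac)
      then have "parity S u * parity S t * (parity S s * parity S u) = parity S s * parity S t"
        by simp
      then show ?thesis
        by (simp only: mult_scaleR_left mult_scaleR_right scaleR_scaleR)
    qed
    then have "(twist S T X ** twist S T Y) $ s $ t
      = (\<Sum>u\<in>UNIV. (parity S s * parity S t) *\<^sub>R (X $ flips T s $ flips T u * Y $ flips T u $ flips T t))"
      by (simp add: matrix_matrix_mult_def twist_def del: mult_scaleR_left mult_scaleR_right)
    also have "\<dots> = (\<Sum>u\<in>UNIV. (parity S s * parity S t) *\<^sub>R (X $ flips T s $ u * Y $ u $ flips T t))"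
      by (rule sum_flips)
    also have "\<dots> = twist S T (X ** Y) $ s $ t"
      by (simp add: matrix_matrix_mult_def twist_def scaleR_sum_right)
    finally show ?thesis .
  qed
  then show ?thesis by (simp add: vec_eq_iff)
qed

lemma dagger_twist: "dagger (twist S T X) = twist S T (dagger X)"
  by (simp add: dagger_def twist_def vec_eq_iff mult.commute)

lemma mat_exp_twist: "twist S T (mat_exp A) = mat_exp (twist S T A)"
  by (intro mat_exp_hom linear_twist twist_mult twist_mat1)

text \<open>
  Summing over \<open>S\<close> removes the off-diagonal entries, and summing over \<open>T\<close> makes the diagonal
  constant.
\<close>

lemma sum_twist: "(\<Sum>S\<in>UNIV. \<Sum>T\<in>UNIV. twist S T X) = mat (2 ^ CARD('m) * trace X)"
  for X :: "'m::finite op"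
proof -
  have "(\<Sum>S\<in>UNIV. \<Sum>T\<in>UNIV. twist S T X) $ s $ t = mat (2 ^ CARD('m) * trace X) $ s $ t" for s t
  proof -
    have "(\<Sum>S\<in>UNIV. \<Sum>T\<in>UNIV. twist S T X) $ s $ t
      = (\<Sum>S\<in>UNIV. (parity S s * parity S t) *\<^sub>R (\<Sum>T\<in>UNIV. X $ flips T s $ flips T t))"
      by (simp add: twist_def scaleR_sum_right)
    also have "\<dots> = (\<Sum>S\<in>UNIV. parity S s * parity S t) *\<^sub>R (\<Sum>T\<in>UNIV. X $ flips T s $ flips T t)"
      by (rule scaleR_sum_left[symmetric])
    also have "\<dots> = mat (2 ^ CARD('m) * trace X) $ s $ t"
      using sum_flips_sets[of "\<lambda>u. X $ u $ u" s]
      by (auto simp: sum_parity mat_def trace_def scaleR_conv_of_real)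
    finally show ?thesis .
  qed
  then show ?thesis by (simp add: vec_eq_iff)
qed

lemma mat_mult_left: "mat c ** A = (\<chi> i j. c * A $ i $ j)"
  by (simp add: matrix_matrix_mult_def mat_def vec_eq_iff if_distrib[of "\<lambda>x. x * _"] cong: if_cong)

lemma card_sets_sq: "real CARD('m::finite set) * real CARD('m set) = 4 ^ CARD('m)"
  using card_Pow[of "UNIV :: 'm set"] by (simp flip: power_mult_distrib)

lemma card_config: "CARD('m::finite \<Rightarrow> 2) = 2 ^ CARD('m)"
  by (simp add: card_fun)

text \<open>
  Golden-Thompson bounds each summand by the logarithm of a quantity that is linear in the
  twisted \<open>exp A\<close>.  Jensen's inequality moves the average inside the logarithm, where the average of
  the twisted matrices is a multiple of the identity.
\<close>

lemma sum_twist_ln_le: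
  fixes A B :: "'m::finite op"
  assumes A: "dagger A = A" and B: "dagger B = B"
  defines "F \<equiv> \<lambda>X :: 'm op. ln (retr (mat_exp X) / 2 ^ CARD('m))"
  shows "(\<Sum>S\<in>UNIV. \<Sum>T\<in>UNIV. F (twist S T A + B)) \<le> 4 ^ CARD('m) * (F A + F B)"
proof -
  let ?N = "2 ^ CARD('m) :: real"
  let ?I = "UNIV :: ('m set \<times> 'm set) set"
  let ?y = "\<lambda>(S, T). retr (mat_exp (twist S T A) ** mat_exp B) / ?N"
  let ?c = "(retr (mat_exp A) / ?N) * (retr (mat_exp B) / ?N)"
  have her: "dagger (twist S T A) = twist S T A" for S T
    by (simp add: dagger_twist A)
  have pos: "0 < retr (mat_exp (twist S T A + B))" for S T
    by (rule retr_mat_exp_pos) (simp add: dagger_add her B)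
  have gt: "retr (mat_exp (twist S T A + B)) \<le> retr (mat_exp (twist S T A) ** mat_exp B)" for S T
    by (rule golden_thompson[OF her B])
  have card: "real (card ?I) = 4 ^ CARD('m)"
    by (simp add: card_cartesian_product card_sets_sq[symmetric] flip: UNIV_Times_UNIV)
  have four: "(4 :: real) ^ CARD('m) = ?N * ?N"
    by (simp flip: power_mult_distrib)
  have "(\<Sum>p\<in>?I. ?y p) = (\<Sum>S\<in>UNIV. \<Sum>T\<in>UNIV. retr (mat_exp (twist S T A) ** mat_exp B) / ?N)"
    by (simp add: sum.cartesian_product)
  also have "\<dots> = retr ((\<Sum>S\<in>UNIV. \<Sum>T\<in>UNIV. twist S T (mat_exp A)) ** mat_exp B) / ?N"
    by (simp add: bounded_bilinear.sum_left[OF bounded_bilinear_matrix_mult] mat_exp_twist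
        linear_sum[OF bounded_linear.linear[OF bounded_linear_retr]] flip: sum_divide_distrib)
  also have "\<dots> = retr (mat_exp A) * retr (mat_exp B)"
    unfolding sum_twist mat_mult_left trace_hermitian[OF dagger_mat_exp[OF A]]
    by (simp add: retr_def trace_def sum_distrib_left[symmetric] mult.assoc)
  finally have sum: "(\<Sum>p\<in>?I. ?y p) = real (card ?I) * ?c"
    unfolding card four by (simp add: field_simps)
  have c: "0 < ?c"
    using retr_mat_exp_pos[OF A] retr_mat_exp_pos[OF B] by simp
  have "(\<Sum>S\<in>UNIV. \<Sum>T\<in>UNIV. F (twist S T A + B)) = (\<Sum>(S, T)\<in>?I. F (twist S T A + B))"
    by (simp add: sum.cartesian_product)
  also have "\<dots> \<le> (\<Sum>p\<in>?I. ln (?y p))"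
  proof (rule sum_mono, clarify)
    fix S T
    show "F (twist S T A + B) \<le> ln (retr (mat_exp (twist S T A) ** mat_exp B) / ?N)"
      unfolding F_def using pos[of S T] gt[of S T]
      by (intro ln_mono divide_right_mono) (auto intro: divide_pos_pos less_le_trans)
  qed
  also have "\<dots> \<le> real (card ?I) * ln ?c"
    using less_le_trans[OF pos gt] by (intro sum_ln_le sum c) auto
  also have "ln ?c = F A + F B"
    using retr_mat_exp_pos[OF A] retr_mat_exp_pos[OF B] unfolding F_def by (intro ln_mult_pos) auto
  also note card
  finally show ?thesis .
qed

section \<open>The Hamiltonian as a linear function of the disorder\<close>

definition disorder_op :: "'m \<times> 'm + 'm \<Rightarrow> 'm::finite op" where
  "disorder_op a = (case a of
     Inl (i, j) \<Rightarrow> (1 / sqrt (real CARD('m))) *\<^sub>R (site_op pauli_z i ** site_op pauli_z j)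
   | Inr i \<Rightarrow> site_op pauli_x i)"

definition ham :: "('m \<times> 'm + 'm \<Rightarrow> real) \<Rightarrow> 'm::finite op" where
  "ham w = (\<Sum>a\<in>UNIV. w a *\<^sub>R disorder_op a)"

lemma qsk_hamiltonian_eq_ham:
  fixes J :: "'m::finite \<times> 'm \<Rightarrow> real"
  shows "qsk_hamiltonian \<beta> h J K = ham (case_sum (\<lambda>p. \<beta> * J p) (\<lambda>i. h * K i))"
proof -
  have "ham (case_sum (\<lambda>p. \<beta> * J p) (\<lambda>i. h * K i))
      = (\<Sum>p\<in>UNIV. (\<beta> * J p) *\<^sub>R disorder_op (Inl p)) + (\<Sum>i\<in>UNIV. (h * K i) *\<^sub>R (disorder_op (Inr i) :: 'm op))"
    unfolding ham_def UNIV_Plus_UNIV[symmetric] by (subst sum.Plus) simp_all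
  also have "(\<Sum>p\<in>UNIV. (\<beta> * J p) *\<^sub>R (disorder_op (Inl p) :: 'm op))
      = (\<Sum>i\<in>UNIV. \<Sum>j\<in>UNIV. (\<beta> * J (i, j)) *\<^sub>R disorder_op (Inl (i, j)))"
    by (simp add: sum.cartesian_product)
  finally show ?thesis
    by (simp add: qsk_hamiltonian_def disorder_op_def scaleR_sum_right mult.commute)
qed

lemma prod_indicator: "(\<Prod>k\<in>UNIV. if P k then 1 else 0) = (if \<forall>k. P k then 1 else (0 :: 'a::comm_semiring_1))"
  for P :: "'m::finite \<Rightarrow> bool"
  by (auto intro!: prod.neutral prod_zero)

lemma pauli_z_entry: "pauli_z $ a $ b = (if a = b then complex_of_real (spin a) else 0)"
  using exhaust_2[of a] exhaust_2[of b] by (auto simp: pauli_z_def spin_def)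

lemma pauli_x_entry: "pauli_x $ a $ b = (if a = b then 0 else 1)"
  using exhaust_2[of a] exhaust_2[of b] by (auto simp: pauli_x_def)

lemma site_z_entry: "site_op pauli_z i $ s $ t = (if s = t then complex_of_real (spin (s i)) else 0)"
proof (cases "s = t")
  case True
  then have "site_op pauli_z i $ s $ t = (\<Prod>k\<in>UNIV. if k = i then complex_of_real (spin (s k)) else 1)"
    unfolding site_op_def tensor_op_def vec_lambda_beta
    by (intro prod.cong) (simp_all add: pauli_z_entry mat_def)
  then show ?thesis using True by simp
next
  case False
  then obtain k where "s k \<noteq> t k" by auto
  then have "site_op pauli_z i $ s $ t = 0"
    unfolding site_op_def tensor_op_def
    by (auto simp: pauli_z_entry mat_def intro!: prod_zero bexI[of _ k])
  then show ?thesis using False by simp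
qed

lemma site_x_entry: "site_op pauli_x i $ s $ t = (if t = flips {i} s then 1 else 0)"
proof -
  have "site_op pauli_x i $ s $ t = (\<Prod>k\<in>UNIV. if t k = flips {i} s k then 1 else 0)"
    unfolding site_op_def tensor_op_def vec_lambda_beta
  proof (rule prod.cong)
    show "(if k = i then pauli_x else mat 1) $ s k $ t k = (if t k = flips {i} s k then 1 else 0)" for k
      using exhaust_2[of "s k"] exhaust_2[of "t k"] by (auto simp: pauli_x_entry mat_def flips_def)
  qed simp
  then show ?thesis
    by (simp add: prod_indicator fun_eq_iff)
qed

text \<open>
  The sign that a spin at site \<open>i\<close> acquires when the sites in \<open>T\<close> are flipped.  By the symmetry
  between \<open>\<sigma>\<^sup>x\<close> and \<open>\<sigma>\<^sup>z\<close> it is also the sign that \<open>\<sigma>\<^sup>x\<^sub>i\<close> acquires under conjugation by the \<open>\<sigma>\<^sup>z\<close>'s on \<open>T\<close>.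
\<close>

definition flip_sign :: "'m set \<Rightarrow> 'm \<Rightarrow> real" where
  "flip_sign T i = (if i \<in> T then -1 else 1)"

definition twist_sign :: "'m set \<Rightarrow> 'm set \<Rightarrow> 'm \<times> 'm + 'm \<Rightarrow> real" where
  "twist_sign S T a = (case a of Inl (i, j) \<Rightarrow> flip_sign T i * flip_sign T j | Inr i \<Rightarrow> flip_sign S i)"

lemma twist_sign_sq: "(twist_sign S T a)\<^sup>2 = 1"
  by (simp add: twist_sign_def flip_sign_def split: sum.split prod.split)

lemma spin_flips: "spin (flips T s i) = flip_sign T i * spin (s i)"
  using exhaust_2[of "s i"] by (auto simp: spin_def flips_def flip_sign_def)

lemma parity_flip: "parity S (flips {i} s) = flip_sign S i * parity S s" for i :: "'m::finite"
proof -
  have "parity S (flips {i} s) = (\<Prod>k\<in>S. (if k = i then -1 else 1) * spin (s k))"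
    unfolding parity_def by (simp add: spin_flips flip_sign_def)
  also have "\<dots> = flip_sign S i * parity S s"
    by (simp add: prod.distrib parity_def flip_sign_def)
  finally show ?thesis .
qed

lemma twist_site_z: "twist S T (site_op pauli_z i) = flip_sign T i *\<^sub>R site_op pauli_z i"
proof -
  have "twist S T (site_op pauli_z i) $ s $ t = (flip_sign T i *\<^sub>R site_op pauli_z i) $ s $ t" for s t
    by (cases "s = t") (simp_all add: twist_def site_z_entry flips_eq_iff spin_flips complex_eq_iff)
  then show ?thesis by (simp add: vec_eq_iff)
qed

lemma twist_site_x: "twist S T (site_op pauli_x i) = flip_sign S i *\<^sub>R site_op pauli_x i"
proof -
  have "flips T t = flips {i} (flips T s) \<longleftrightarrow> t = flips {i} s" for s t
    by (simp add: flips_commute[of "{i}"] flips_eq_iff)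
  moreover have "parity S s * (flip_sign S i * parity S s) = flip_sign S i" for s
    by (simp add: mult.left_commute[of "parity S s"])
  ultimately show ?thesis
    by (simp add: vec_eq_iff twist_def site_x_entry parity_flip)
qed

lemma twist_disorder_op: "twist S T (disorder_op a) = twist_sign S T a *\<^sub>R disorder_op a"
  by (auto simp: disorder_op_def twist_sign_def linear_scale[OF linear_twist] twist_mult twist_site_z
      twist_site_x scaleR_mult_left scaleR_mult_right split: sum.split)

lemma dagger_site_z: "dagger (site_op pauli_z i) = site_op pauli_z i"
  by (auto simp: dagger_def vec_eq_iff site_z_entry)

lemma dagger_site_x: "dagger (site_op pauli_x i) = site_op pauli_x i"
  by (auto simp: dagger_def vec_eq_iff site_x_entry)

lemma site_z_commute: "site_op pauli_z i ** site_op pauli_z j = site_op pauli_z j ** site_op pauli_z i"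
  by (auto simp: matrix_matrix_mult_def vec_eq_iff site_z_entry mult.commute intro!: sum.cong)

lemma dagger_disorder_op: "dagger (disorder_op a) = disorder_op a"
  by (auto simp: disorder_op_def dagger_scaleR dagger_mult dagger_site_z dagger_site_x
      split: sum.split intro: site_z_commute)

lemma dagger_ham: "dagger (ham w) = ham w"
  by (simp add: ham_def linear_sum[OF linear_dagger] dagger_scaleR dagger_disorder_op)

lemma twist_ham: "twist S T (ham w) = ham (\<lambda>a. twist_sign S T a * w a)"
  by (simp add: ham_def linear_sum[OF linear_twist] linear_scale[OF linear_twist] twist_disorder_op
      mult.commute)

lemma ham_add: "ham (\<lambda>a. v a + w a) = ham v + ham w"
  by (simp add: ham_def scaleR_add_left sum.distrib)

lemma norm_ham_le: "norm (ham w) \<le> (\<Sum>a\<in>UNIV. \<bar>w a\<bar> * norm (disorder_op a :: 'm::finite op))"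
  for w :: "'m::finite \<times> 'm + 'm \<Rightarrow> real"
  unfolding ham_def by (rule sum_norm_le) simp

text \<open>
  The free energy before averaging over the disorder.
\<close>

definition log_partition :: "('m::finite \<times> 'm + 'm \<Rightarrow> real) \<Rightarrow> real" where
  "log_partition w = ln (retr (mat_exp (ham w)) / 2 ^ CARD('m))"

lemma sum_log_partition_le:
  fixes v w :: "'m::finite \<times> 'm + 'm \<Rightarrow> real"
  shows "(\<Sum>S\<in>UNIV. \<Sum>T\<in>UNIV. log_partition (\<lambda>a. twist_sign S T a * v a + w a))
     \<le> 4 ^ CARD('m) * (log_partition v + log_partition w)"
  using sum_twist_ln_le[OF dagger_ham[of v] dagger_ham[of w]]
  by (simp add: log_partition_def twist_ham ham_add)

lemma abs_log_partition_le:
  fixes w :: "'m::finite \<times> 'm + 'm \<Rightarrow> real"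
  shows "\<bar>log_partition w\<bar> \<le> (\<Sum>a\<in>UNIV. \<bar>w a\<bar> * norm (disorder_op a :: 'm op))"
  using abs_ln_retr_mat_exp_le[OF dagger_ham[of w]] norm_ham_le[of w]
  by (simp add: log_partition_def card_config)

section \<open>Linear combinations of independent Gaussian vectors\<close>

lemma prob_space_std_normal: "prob_space std_normal_distribution"
  by (rule prob_space_normal_density) simp

lemma char_scaled_std_normal:
  "char (distr std_normal_distribution borel (\<lambda>x. a * x)) t = complex_of_real (exp (- ((a * t)\<^sup>2) / 2))"
proof -
  have "char (distr std_normal_distribution borel (\<lambda>x. a * x)) t = char std_normal_distribution (a * t)"
    unfolding char_def by (subst integral_distr) (simp_all add: mult_ac)
  then show ?thesis by (simp add: char_std_normal_distribution)
qed

text \<open>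
  Both sides have the characteristic function \<open>exp (- (a\<^sup>2 + b\<^sup>2) t\<^sup>2 / 2)\<close>.  This also covers
  \<open>a = b = 0\<close>, where the law is a point mass and has no density.
\<close>

lemma distr_add_std_normal:
  "distr (std_normal_distribution \<Otimes>\<^sub>M std_normal_distribution) borel (\<lambda>p. a * fst p + b * snd p)
     = distr std_normal_distribution borel (\<lambda>z. sqrt (a\<^sup>2 + b\<^sup>2) * z)"
proof (rule Levy_uniqueness)
  let ?N = std_normal_distribution
  interpret N: prob_space ?N by (rule prob_space_std_normal)
  interpret NN: pair_prob_space ?N ?N ..
  show "real_distribution (distr (?N \<Otimes>\<^sub>M ?N) borel (\<lambda>p. a * fst p + b * snd p))"
    by (intro NN.real_distribution_distr) simp
  show "real_distribution (distr ?N borel (\<lambda>z. sqrt (a\<^sup>2 + b\<^sup>2) * z))"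
    by (intro N.real_distribution_distr) simp
  show "char (distr (?N \<Otimes>\<^sub>M ?N) borel (\<lambda>p. a * fst p + b * snd p))
      = char (distr ?N borel (\<lambda>z. sqrt (a\<^sup>2 + b\<^sup>2) * z))"
  proof
    fix t :: real
    have int: "integrable (?N \<Otimes>\<^sub>M ?N) (\<lambda>p. iexp (t * (a * fst p + b * snd p)))"
      by (rule NN.integrable_const_bound[where B = 1]) simp_all
    have "char (distr (?N \<Otimes>\<^sub>M ?N) borel (\<lambda>p. a * fst p + b * snd p)) t
        = (CLINT p|?N \<Otimes>\<^sub>M ?N. iexp (t * (a * fst p + b * snd p)))"
      unfolding char_def by (subst integral_distr) simp_all
    also have "\<dots> = (CLINT x|?N. CLINT y|?N. iexp (t * (a * x + b * y)))"
      using NN.integral_fst'[OF int] by simp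
    also have "\<dots> = (CLINT x|?N. CLINT y|?N. iexp (t * (a * x)) * iexp (t * (b * y)))"
      by (simp add: exp_add[symmetric] distrib_left)
    also have "\<dots> = char (distr ?N borel (\<lambda>x. a * x)) t * char (distr ?N borel (\<lambda>x. b * x)) t"
      unfolding char_def by (subst (1 2) integral_distr) simp_all
    also have "\<dots> = complex_of_real (exp (- ((a * t)\<^sup>2) / 2) * exp (- ((b * t)\<^sup>2) / 2))"
      by (simp only: char_scaled_std_normal of_real_mult)
    also have "\<dots> = char (distr ?N borel (\<lambda>z. sqrt (a\<^sup>2 + b\<^sup>2) * z)) t"
      unfolding char_scaled_std_normal
      by (simp add: exp_add[symmetric] power_mult_distrib field_simps)
    finally show "char (distr (?N \<Otimes>\<^sub>M ?N) borel (\<lambda>p. a * fst p + b * snd p)) t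
        = char (distr ?N borel (\<lambda>z. sqrt (a\<^sup>2 + b\<^sup>2) * z)) t" .
  qed
qed

text \<open>
  The preceding lemma after Fubini; this is the form needed for each coordinate of a product
  measure.
\<close>

lemma std_normal_slice:
  assumes [measurable]: "A \<in> sets borel"
  shows "(\<integral>\<^sup>+x. emeasure std_normal_distribution {y. a * x + b * y \<in> A} \<partial>std_normal_distribution)
     = emeasure (distr std_normal_distribution borel (\<lambda>z. sqrt (a\<^sup>2 + b\<^sup>2) * z)) A"
proof -
  let ?N = std_normal_distribution
  interpret N: prob_space ?N by (rule prob_space_std_normal)
  have [measurable]: "{p. a * fst p + b * snd p \<in> A} \<in> sets (?N \<Otimes>\<^sub>M ?N)"
    using measurable_sets[of "\<lambda>p. a * fst p + b * snd p" "?N \<Otimes>\<^sub>M ?N" borel A]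
    by (simp add: vimage_def space_pair_measure)
  have "emeasure (distr (?N \<Otimes>\<^sub>M ?N) borel (\<lambda>p. a * fst p + b * snd p)) A
      = emeasure (?N \<Otimes>\<^sub>M ?N) {p. a * fst p + b * snd p \<in> A}"
    by (subst emeasure_distr) (simp_all add: vimage_def space_pair_measure)
  also have "\<dots> = (\<integral>\<^sup>+x. emeasure ?N (Pair x -` {p. a * fst p + b * snd p \<in> A}) \<partial>?N)"
    by (rule N.emeasure_pair_measure_alt) measurable
  finally show ?thesis
    by (simp add: distr_add_std_normal vimage_def)
qed

abbreviation gauss_vec :: "('i::finite \<Rightarrow> real) measure" where
  "gauss_vec \<equiv> (\<Pi>\<^sub>M a\<in>UNIV. std_normal_distribution)"

lemma prob_space_gauss_vec: "prob_space (gauss_vec :: ('i::finite \<Rightarrow> real) measure)"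
  by (intro prob_space_PiM prob_space_std_normal)

lemma measurable_gauss_vec_component [measurable]:
  "(\<lambda>w. w a) \<in> borel_measurable (gauss_vec :: ('i::finite \<Rightarrow> real) measure)"
  using measurable_component_singleton[of a UNIV "\<lambda>_::'i. std_normal_distribution"]
  by (simp add: measurable_def)

lemma measurable_into_gauss_vec:
  assumes "\<And>a. (\<lambda>x. f x a) \<in> borel_measurable M"
  shows "f \<in> measurable M (gauss_vec :: ('i::finite \<Rightarrow> real) measure)"
  by (rule measurable_PiM_single') (use assms in \<open>auto simp: measurable_def\<close>)

text \<open>
  The coordinates of the combination are independent.  It suffices to compare measures of boxes:
  for fixed first vector the conditional measure of a box is a product over the coordinates, and
  the integral of this product over the first vector factorises.
\<close>

lemma distr_gauss_vec_add:
  fixes c d :: "'i::finite \<Rightarrow> real"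
  shows "distr (gauss_vec \<Otimes>\<^sub>M gauss_vec) gauss_vec (\<lambda>p a. c a * fst p a + d a * snd p a)
       = (\<Pi>\<^sub>M a\<in>UNIV. distr std_normal_distribution borel (\<lambda>z. sqrt ((c a)\<^sup>2 + (d a)\<^sup>2) * z))"
    (is "?L = (\<Pi>\<^sub>M a\<in>UNIV. ?\<nu> a)")
proof -
  let ?N = std_normal_distribution
  let ?G = "gauss_vec :: ('i \<Rightarrow> real) measure"
  interpret N: prob_space ?N by (rule prob_space_std_normal)
  interpret G: prob_space ?G by (rule prob_space_gauss_vec)
  interpret PN: product_prob_space "\<lambda>_::'i. ?N" UNIV ..
  interpret \<nu>: prob_space "?\<nu> a" for a
    by (rule N.prob_space_distr) simp
  interpret P\<nu>: product_prob_space ?\<nu> UNIV ..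
  have meas: "(\<lambda>p a. c a * fst p a + d a * snd p a) \<in> measurable (?G \<Otimes>\<^sub>M ?G) ?G"
    by (rule measurable_into_gauss_vec) measurable
  show ?thesis
  proof (rule P\<nu>.PiM_eqI)
    show "sets ?L = sets (\<Pi>\<^sub>M a\<in>UNIV. ?\<nu> a)"
      by (simp cong: sets_PiM_cong)
    fix A :: "'i \<Rightarrow> real set" assume "\<And>a. a \<in> UNIV \<Longrightarrow> A a \<in> sets (?\<nu> a)"
    then have A [measurable]: "A a \<in> sets borel" for a by simp
    let ?X = "{p \<in> space (?G \<Otimes>\<^sub>M ?G). \<forall>a. c a * fst p a + d a * snd p a \<in> A a}"
    have X [measurable]: "?X \<in> sets (?G \<Otimes>\<^sub>M ?G)"
      by measurable
    have sl: "{y. c a * x + d a * y \<in> A a} \<in> sets ?N" for a x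
      using measurable_sets[of "\<lambda>y. c a * x + d a * y" borel borel "A a"]
      by (simp add: vimage_def)
    have "emeasure ?L (Pi\<^sub>E UNIV A) = emeasure (?G \<Otimes>\<^sub>M ?G) ?X"
      using A by (subst emeasure_distr[OF meas])
        (auto intro!: sets_PiM_I_finite arg_cong[where f = "emeasure _"])
    also have "\<dots> = (\<integral>\<^sup>+g. emeasure ?G (Pair g -` ?X) \<partial>?G)"
      by (rule G.emeasure_pair_measure_alt[OF X])
    also have "\<dots> = (\<integral>\<^sup>+g. (\<Prod>a\<in>UNIV. emeasure ?N {y. c a * g a + d a * y \<in> A a}) \<partial>?G)"
    proof (rule nn_integral_cong)
      fix g :: "'i \<Rightarrow> real"
      have "Pair g -` ?X = Pi\<^sub>E UNIV (\<lambda>a. {y. c a * g a + d a * y \<in> A a})"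
        by (auto simp: space_pair_measure space_PiM PiE_def)
      then show "emeasure ?G (Pair g -` ?X) = (\<Prod>a\<in>UNIV. emeasure ?N {y. c a * g a + d a * y \<in> A a})"
        using sl by (simp add: PN.emeasure_PiM)
    qed
    also have "\<dots> = (\<Prod>a\<in>UNIV. \<integral>\<^sup>+x. emeasure ?N {y. c a * x + d a * y \<in> A a} \<partial>?N)"
    proof (rule PN.product_nn_integral_prod)
      fix a :: 'i
      have "{p. c a * fst p + d a * snd p \<in> A a} \<in> sets (?N \<Otimes>\<^sub>M ?N)"
        using measurable_sets[of "\<lambda>p. c a * fst p + d a * snd p" "?N \<Otimes>\<^sub>M ?N" borel "A a"]
        by (simp add: vimage_def space_pair_measure)
      from N.measurable_emeasure_Pair[OF this]
      show "(\<lambda>x. emeasure ?N {y. c a * x + d a * y \<in> A a}) \<in> borel_measurable ?N"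
        by (simp add: vimage_def)
    qed simp
    also have "\<dots> = (\<Prod>a\<in>UNIV. emeasure (?\<nu> a) (A a))"
      by (intro prod.cong refl std_normal_slice A)
    finally show "emeasure ?L (Pi\<^sub>E UNIV A) = (\<Prod>a\<in>UNIV. emeasure (?\<nu> a) (A a))" .
  qed simp
qed

text \<open>
  The right-hand side is rewritten as a combination of two Gaussian vectors as well, the second one
  with coefficient \<open>0\<close>, so that \<open>distr_gauss_vec_add\<close> identifies both sides with the same product
  measure.
\<close>

theorem distr_gauss_vec_combination:
  fixes c d :: "'i::finite \<Rightarrow> real"
  shows "distr (gauss_vec \<Otimes>\<^sub>M gauss_vec) gauss_vec (\<lambda>p a. c a * fst p a + d a * snd p a)
       = distr gauss_vec gauss_vec (\<lambda>g a. sqrt ((c a)\<^sup>2 + (d a)\<^sup>2) * g a)"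
proof -
  let ?G = "gauss_vec :: ('i \<Rightarrow> real) measure"
  let ?r = "\<lambda>a. sqrt ((c a)\<^sup>2 + (d a)\<^sup>2)"
  interpret G: prob_space ?G by (rule prob_space_gauss_vec)
  have meas: "(\<lambda>g a. ?r a * g a) \<in> measurable ?G ?G"
    by (rule measurable_into_gauss_vec) measurable
  have "distr ?G ?G (\<lambda>g a. ?r a * g a) = distr (distr (?G \<Otimes>\<^sub>M ?G) ?G fst) ?G (\<lambda>g a. ?r a * g a)"
    by (simp only: G.distr_pair_fst)
  also have "\<dots> = distr (?G \<Otimes>\<^sub>M ?G) ?G (\<lambda>p a. ?r a * fst p a + 0 * snd p a)"
    by (subst distr_distr[OF meas]) (simp_all add: comp_def)
  also have "\<dots> = (\<Pi>\<^sub>M a\<in>UNIV. distr std_normal_distribution borel (\<lambda>z. ?r a * z))"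
    by (subst distr_gauss_vec_add) simp
  finally show ?thesis
    by (simp only: distr_gauss_vec_add)
qed

lemma
  fixes c d :: "'i::finite \<Rightarrow> real" and f :: "('i \<Rightarrow> real) \<Rightarrow> real"
  assumes f: "f \<in> borel_measurable gauss_vec"
  shows integral_gauss_vec_combination:
    "(\<integral>p. f (\<lambda>a. c a * fst p a + d a * snd p a) \<partial>(gauss_vec \<Otimes>\<^sub>M gauss_vec))
      = (\<integral>g. f (\<lambda>a. sqrt ((c a)\<^sup>2 + (d a)\<^sup>2) * g a) \<partial>gauss_vec)"
    and integrable_gauss_vec_combination:
    "integrable (gauss_vec \<Otimes>\<^sub>M gauss_vec) (\<lambda>p. f (\<lambda>a. c a * fst p a + d a * snd p a))
      \<longleftrightarrow> integrable gauss_vec (\<lambda>g. f (\<lambda>a. sqrt ((c a)\<^sup>2 + (d a)\<^sup>2) * g a))"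
proof -
  let ?G = "gauss_vec :: ('i \<Rightarrow> real) measure"
  have X: "(\<lambda>p a. c a * fst p a + d a * snd p a) \<in> measurable (?G \<Otimes>\<^sub>M ?G) ?G"
    by (rule measurable_into_gauss_vec) measurable
  have Y: "(\<lambda>g a. sqrt ((c a)\<^sup>2 + (d a)\<^sup>2) * g a) \<in> measurable ?G ?G"
    by (rule measurable_into_gauss_vec) measurable
  note eq = distr_gauss_vec_combination[of c d]
  show "(\<integral>p. f (\<lambda>a. c a * fst p a + d a * snd p a) \<partial>(?G \<Otimes>\<^sub>M ?G))
      = (\<integral>g. f (\<lambda>a. sqrt ((c a)\<^sup>2 + (d a)\<^sup>2) * g a) \<partial>?G)"
    using arg_cong[OF eq, of "\<lambda>M. integral\<^sup>L M f"] by (simp only: integral_distr[OF X f] integral_distr[OF Y f])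
  show "integrable (?G \<Otimes>\<^sub>M ?G) (\<lambda>p. f (\<lambda>a. c a * fst p a + d a * snd p a))
      \<longleftrightarrow> integrable ?G (\<lambda>g. f (\<lambda>a. sqrt ((c a)\<^sup>2 + (d a)\<^sup>2) * g a))"
    using arg_cong[OF eq, of "\<lambda>M. integrable M f"]
    by (simp only: integrable_distr_eq[OF X f] integrable_distr_eq[OF Y f])
qed

lemma integrable_gauss_vec_component:
  "integrable (gauss_vec :: ('i::finite \<Rightarrow> real) measure) (\<lambda>g. g a)"
proof -
  have "distr (gauss_vec :: ('i \<Rightarrow> real) measure) std_normal_distribution (\<lambda>g. g a) = std_normal_distribution"
    by (rule distr_PiM_component) (simp_all add: prob_space_std_normal)
  moreover have "integrable std_normal_distribution (\<lambda>x. x)"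
    using integrable_std_normal_distribution_moment[of 1] by simp
  ultimately have "integrable (distr (gauss_vec :: ('i \<Rightarrow> real) measure) std_normal_distribution (\<lambda>g. g a)) (\<lambda>x. x)"
    by simp
  then show ?thesis
    by (rule integrable_distr[rotated]) (rule measurable_component_singleton, simp)
qed

section \<open>Integration over the disorder\<close>

lemma mpow_entry_measurable:
  assumes "\<And>i j. (\<lambda>x. X x $ i $ j) \<in> borel_measurable M"
  shows "(\<lambda>x. mpow (X x) k $ i $ j) \<in> borel_measurable M"
proof (induction k arbitrary: i j)
  case (Suc k)
  show ?case
    by (simp add: mpow_Suc matrix_matrix_mult_def)
       (intro borel_measurable_sum borel_measurable_times assms Suc.IH)
qed simp

text \<open>
  The trace is a pointwise limit of polynomials in the entries.
\<close>

lemma retr_mat_exp_measurable: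
  assumes "\<And>i j. (\<lambda>x. X x $ i $ j) \<in> borel_measurable M"
  shows "(\<lambda>x. retr (mat_exp (X x))) \<in> borel_measurable M"
proof (rule borel_measurable_LIMSEQ_real)
  show "(\<lambda>n. retr (mpow (mat 1 + (1 / real n) *\<^sub>R X x) n)) \<longlonglongrightarrow> retr (mat_exp (X x))" for x
    by (intro bounded_linear.tendsto[OF bounded_linear_retr] mat_exp_limit tendsto_const)
  have "(\<lambda>x. (mat 1 + (1 / real n) *\<^sub>R X x) $ i $ j) \<in> borel_measurable M" for n i j
    using assms[of i j] by simp
  note [measurable] = mpow_entry_measurable[OF this]
  show "(\<lambda>x. retr (mpow (mat 1 + (1 / real n) *\<^sub>R X x) n)) \<in> borel_measurable M" for n
    by (simp add: retr_def trace_def)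
qed

lemma log_partition_measurable:
  "log_partition \<in> borel_measurable (gauss_vec :: ('m::finite \<times> 'm + 'm \<Rightarrow> real) measure)"
proof -
  have "(\<lambda>w. (ham w :: 'm op) $ i $ j) \<in> borel_measurable gauss_vec" for i j
    by (simp add: ham_def)
  note [measurable] = retr_mat_exp_measurable[OF this]
  show ?thesis unfolding log_partition_def[abs_def] by measurable
qed

text \<open>
  The logarithm is bounded by the norm of the Hamiltonian, which is at most linear in the Gaussians.
\<close>

lemma integrable_log_partition:
  fixes r :: "'m::finite \<times> 'm + 'm \<Rightarrow> real"
  shows "integrable gauss_vec (\<lambda>g. log_partition (\<lambda>a. r a * g a))"
proof (rule Bochner_Integration.integrable_bound)
  show "integrable gauss_vec (\<lambda>g. \<Sum>a\<in>UNIV. \<bar>r a * g a\<bar> * norm (disorder_op a :: 'm op))"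
    by (intro Bochner_Integration.integrable_sum integrable_mult_left integrable_abs integrable_mult_right
        integrable_gauss_vec_component)
  have "(\<lambda>(g :: 'm \<times> 'm + 'm \<Rightarrow> real) a. r a * g a) \<in> measurable gauss_vec gauss_vec"
    by (rule measurable_into_gauss_vec) measurable
  from measurable_compose[OF this log_partition_measurable]
  show "(\<lambda>g. log_partition (\<lambda>a. r a * g a)) \<in> borel_measurable gauss_vec" .
  show "AE g in gauss_vec. norm (log_partition (\<lambda>a. r a * g a))
      \<le> norm (\<Sum>a\<in>UNIV. \<bar>r a * g a\<bar> * norm (disorder_op a :: 'm op))"
    by (intro AE_I2) (simp only: real_norm_def, rule order_trans[OF abs_log_partition_le abs_ge_self])
qed

definition strength :: "real \<Rightarrow> real \<Rightarrow> 'm \<times> 'm + 'm \<Rightarrow> real" where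
  "strength \<beta> h = case_sum (\<lambda>_. \<beta>) (\<lambda>_. h)"

lemma qsk_free_energy_eq:
  "qsk_free_energy TYPE('m::finite) \<beta> h
     = (\<integral>g. log_partition (\<lambda>a. strength \<beta> h a * g a) \<partial>(gauss_vec :: ('m \<times> 'm + 'm \<Rightarrow> real) measure))"
proof -
  have "qsk_hamiltonian \<beta> h (\<lambda>p. g (Inl p)) (\<lambda>i. g (Inr i)) = ham (\<lambda>a. strength \<beta> h a * g a)"
    for g :: "'m \<times> 'm + 'm \<Rightarrow> real"
    unfolding qsk_hamiltonian_eq_ham
    by (rule arg_cong[where f = ham]) (auto simp: strength_def fun_eq_iff split: sum.split)
  then show ?thesis
    by (simp add: qsk_free_energy_def disorder_def log_partition_def retr_def)
qed

theorem corollary3p2: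
  fixes \<beta>\<^sub>1 \<beta>\<^sub>2 h\<^sub>1 h\<^sub>2 :: real
  assumes "\<beta>\<^sub>1 \<ge> 0" and "\<beta>\<^sub>2 \<ge> 0" and "h\<^sub>1 \<ge> 0" and "h\<^sub>2 \<ge> 0"
  shows "qsk_free_energy TYPE('m::finite) (sqrt (\<beta>\<^sub>1\<^sup>2 + \<beta>\<^sub>2\<^sup>2)) (sqrt (h\<^sub>1\<^sup>2 + h\<^sub>2\<^sup>2))
         \<le> qsk_free_energy TYPE('m) \<beta>\<^sub>1 h\<^sub>1 + qsk_free_energy TYPE('m) \<beta>\<^sub>2 h\<^sub>2"
proof -
  let ?G = "gauss_vec :: ('m \<times> 'm + 'm \<Rightarrow> real) measure"
  let ?f = "log_partition :: ('m \<times> 'm + 'm \<Rightarrow> real) \<Rightarrow> real"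
  let ?c = "strength \<beta>\<^sub>1 h\<^sub>1 :: 'm \<times> 'm + 'm \<Rightarrow> real"
  let ?d = "strength \<beta>\<^sub>2 h\<^sub>2 :: 'm \<times> 'm + 'm \<Rightarrow> real"
  let ?F = "qsk_free_energy TYPE('m)"
  let ?n = "4 ^ CARD('m) :: real"
  note int = integrable_gauss_vec_combination[OF log_partition_measurable, THEN iffD2,
    OF integrable_log_partition]
  note transfer = integral_gauss_vec_combination[OF log_partition_measurable]
  have abs: "\<bar>?c a\<bar> = ?c a" "\<bar>?d a\<bar> = ?d a" for a
    using assms by (simp_all add: strength_def split: sum.split)
  have law: "(\<integral>p. ?f (\<lambda>a. twist_sign S T a * (?c a * fst p a) + ?d a * snd p a) \<partial>(?G \<Otimes>\<^sub>M ?G))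
      = ?F (sqrt (\<beta>\<^sub>1\<^sup>2 + \<beta>\<^sub>2\<^sup>2)) (sqrt (h\<^sub>1\<^sup>2 + h\<^sub>2\<^sup>2))" for S T
  proof -
    have "sqrt ((twist_sign S T a * ?c a)\<^sup>2 + (?d a)\<^sup>2)
        = strength (sqrt (\<beta>\<^sub>1\<^sup>2 + \<beta>\<^sub>2\<^sup>2)) (sqrt (h\<^sub>1\<^sup>2 + h\<^sub>2\<^sup>2)) a" for a
      by (simp add: power_mult_distrib twist_sign_sq strength_def split: sum.split)
    then show ?thesis
      using transfer[of "\<lambda>a. twist_sign S T a * ?c a" ?d]
      by (simp add: qsk_free_energy_eq mult.assoc)
  qed
  \<comment> \<open>Marginals of the pair of disorders are combinations in which one coefficient vanishes.\<close>
  have F1: "(\<integral>p. ?f (\<lambda>a. ?c a * fst p a) \<partial>(?G \<Otimes>\<^sub>M ?G)) = ?F \<beta>\<^sub>1 h\<^sub>1"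
    using transfer[of ?c "\<lambda>_. 0"] by (simp add: abs qsk_free_energy_eq)
  have F2: "(\<integral>p. ?f (\<lambda>a. ?d a * snd p a) \<partial>(?G \<Otimes>\<^sub>M ?G)) = ?F \<beta>\<^sub>2 h\<^sub>2"
    using transfer[of "\<lambda>_. 0" ?d] by (simp add: abs qsk_free_energy_eq)
  have int1: "integrable (?G \<Otimes>\<^sub>M ?G) (\<lambda>p. ?f (\<lambda>a. ?c a * fst p a))"
    using int[of ?c "\<lambda>_. 0"] by simp
  have int2: "integrable (?G \<Otimes>\<^sub>M ?G) (\<lambda>p. ?f (\<lambda>a. ?d a * snd p a))"
    using int[of "\<lambda>_. 0" ?d] by simp
  have int3: "integrable (?G \<Otimes>\<^sub>M ?G) (\<lambda>p. ?f (\<lambda>a. twist_sign S T a * (?c a * fst p a) + ?d a * snd p a))"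
    for S T
    using int[of "\<lambda>a. twist_sign S T a * ?c a" ?d] by (simp add: mult.assoc)
  have "?n * ?F (sqrt (\<beta>\<^sub>1\<^sup>2 + \<beta>\<^sub>2\<^sup>2)) (sqrt (h\<^sub>1\<^sup>2 + h\<^sub>2\<^sup>2))
      = (\<Sum>S\<in>UNIV. \<Sum>T\<in>UNIV. \<integral>p. ?f (\<lambda>a. twist_sign S T a * (?c a * fst p a) + ?d a * snd p a) \<partial>(?G \<Otimes>\<^sub>M ?G))"
    unfolding law sum_constant card_sets_sq[symmetric] by (simp only: mult.assoc)
  also have "\<dots> = (\<integral>p. (\<Sum>S\<in>UNIV. \<Sum>T\<in>UNIV. ?f (\<lambda>a. twist_sign S T a * (?c a * fst p a) + ?d a * snd p a)) \<partial>(?G \<Otimes>\<^sub>M ?G))"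
    by (simp add: Bochner_Integration.integral_sum int3 Bochner_Integration.integrable_sum)
  also have "\<dots> \<le> (\<integral>p. ?n * (?f (\<lambda>a. ?c a * fst p a) + ?f (\<lambda>a. ?d a * snd p a)) \<partial>(?G \<Otimes>\<^sub>M ?G))"
    by (intro integral_mono Bochner_Integration.integrable_sum int3 integrable_mult_right
        Bochner_Integration.integrable_add int1 int2 sum_log_partition_le)
  also have "\<dots> = ?n * (?F \<beta>\<^sub>1 h\<^sub>1 + ?F \<beta>\<^sub>2 h\<^sub>2)"
    using int1 int2 by (simp add: F1 F2)
  finally show ?thesis by simp
qed

end
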